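(* Let $k\ge 1$ and $n\ge k+1$ be integers. Then $$\mathrm{ex}(n,\mathcal{F}'_k)=(k-1)n-\binom{k}{2}.$$ Furthermore, the $n$-vertex $\mathcal{F}'_k$-saturated graphs with the most edges arise from $(n-1)$-vertex $\mathcal{F}'_k$-saturated graphs with the most edges by adding one vertex with $k-1$ neighbors; that is, every $n$-vertex $\mathcal{F}'_k$-saturated graph with $\mathrm{ex}(n,\mathcal{F}'_k)$ edges can be obtained from some $(n-1)$-vertex $\mathcal{F}'_k$-saturated graph having $\mathrm{ex}(n-1,\mathcal{F}'_k)$ edges by adding one new vertex adjacent to exactly $k-1$ of its vertices.
   Context: All graphs are finite and simple (no loops or multiedges). For a positive integer $k$, $\mathcal{F}'_k$ is the family of $k$-edge-connected graphs; a $k$-edge-connected graph is a graph with at least two vertices that remains connected after deletion of any set of fewer than $k$ edges (so a single vertex is not in $\mathcal{F}'_k$). Given a family $\mathcal{F}$ of graphs, a graph $G$ is $\mathcal{F}$-saturated if (1) no subgraph of $G$ belongs to $\mathcal{F}$, and (2) for every edge $e$ of the complement $\overline{G}$, the graph $G+e$ contains a subgraph belonging to $\mathcal{F}$. (In particular, complete graphs with at most $k$ vertices are $\mathcal{F}'_k$-saturated.) The extremal number $\mathrm{ex}(n,\mathcal{F})$ is the maximum number of edges in an $n$-vertex $\mathcal{F}$-saturated graph. *)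

theory Defs
  imports Complex_Main
begin

datatype 'a graph = Graph (verts: "'a set") (edges: "'a set set")

definition all_edges :: "'a set \<Rightarrow> 'a set set" where
  "all_edges V = {e. e \<subseteq> V \<and> card e = 2}"

definition simple_graph :: "'a graph \<Rightarrow> bool" where
  "simple_graph G \<longleftrightarrow> finite (verts G) \<and> edges G \<subseteq> all_edges (verts G)"

definition subgraph :: "'a graph \<Rightarrow> 'a graph \<Rightarrow> bool" where
  "subgraph H G \<longleftrightarrow> simple_graph H \<and> verts H \<subseteq> verts G \<and> edges H \<subseteq> edges G"

definition complement_graph :: "'a graph \<Rightarrow> 'a graph" where
  "complement_graph G = Graph (verts G) (all_edges (verts G) - edges G)"

definition add_edge :: "'a graph \<Rightarrow> 'a set \<Rightarrow> 'a graph" where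
  "add_edge G e = Graph (verts G) (insert e (edges G))"

definition delete_edges :: "'a graph \<Rightarrow> 'a set set \<Rightarrow> 'a graph" where
  "delete_edges G D = Graph (verts G) (edges G - D)"

definition add_vertex :: "'a graph \<Rightarrow> 'a \<Rightarrow> 'a set \<Rightarrow> 'a graph" where
  "add_vertex G v N = Graph (insert v (verts G)) (edges G \<union> {{v, u} |u. u \<in> N})"

definition adjacent :: "'a graph \<Rightarrow> 'a \<Rightarrow> 'a \<Rightarrow> bool" where
  "adjacent G u v \<longleftrightarrow> {u, v} \<in> edges G"

definition connected_graph :: "'a graph \<Rightarrow> bool" where
  "connected_graph G \<longleftrightarrow>
     verts G \<noteq> {} \<and> (\<forall>u\<in>verts G. \<forall>v\<in>verts G. (adjacent G)\<^sup>*\<^sup>* u v)"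

definition edge_connected_graphs :: "nat \<Rightarrow> 'a graph set" where
  "edge_connected_graphs k =
     {G. simple_graph G \<and> card (verts G) \<ge> 2 \<and>
         (\<forall>D. D \<subseteq> edges G \<and> card D < k \<longrightarrow> connected_graph (delete_edges G D))}"

text \<open>Subgraphs are compared with members of \<open>F\<close> by equality rather than up to
  isomorphism, so \<open>F\<close> is meant to be closed under isomorphism within the vertex type.\<close>

definition saturated :: "'a graph set \<Rightarrow> 'a graph \<Rightarrow> bool" where
  "saturated F G \<longleftrightarrow>
     simple_graph G \<and>
     \<not> (\<exists>H. subgraph H G \<and> H \<in> F) \<and>
     (\<forall>e \<in> edges (complement_graph G). \<exists>H. subgraph H (add_edge G e) \<and> H \<in> F)"

text \<open>Every finite graph is isomorphic to one whose vertices are natural numbers, so the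
  maximum is taken over graphs on the type \<^typ>\<open>nat\<close>; this keeps the extremal number
  independent of the vertex type of the graphs it is compared with. The set is finite;
  \<^const>\<open>Max\<close> is meaningful when some saturated graph on \<open>n\<close> vertices exists.\<close>

definition ex_number :: "nat \<Rightarrow> nat graph set \<Rightarrow> nat" where
  "ex_number n F = Max {card (edges G) |G. saturated F G \<and> card (verts G) = n}"

end

theory Submission
  imports Defs
begin

text \<open>
  Write \<open>f\<close> for \<open>max_edges k\<close>, the function with increments \<open>f (m + 1) - f m = min m (k - 1)\<close>; it is
  \<open>m choose 2\<close> up to \<open>m = k\<close> and \<open>(k - 1) m - (k choose 2)\<close> from there on. Call a graph
  free if none of its subgraphs is \<open>k\<close>-edge-connected.

  A free graph on \<open>m\<close> vertices has at most \<open>f m\<close> edges (\<open>free_card_edges_le\<close>). For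
  \<open>m \<le> k\<close> this only says that the graph is simple. A larger free graph is not itself
  \<open>k\<close>-edge-connected, so fewer than \<open>k\<close> edges join some vertex set of size \<open>a\<close> to its
  complement of size \<open>b\<close>. Both sides are free, and induction reduces the bound to
  \<open>f a + f b + (k - 1) \<le> f (a + b)\<close>. Since \<open>f\<close> is convex, the defect
  \<open>f (a + b) - f a - f b\<close> grows with \<open>a\<close> and with \<open>b\<close>, so it is enough to look at
  \<open>a + b = k + 1\<close>, where the defect is exactly \<open>a b - 1\<close> (\<open>gap_at_Suc\<close>, \<open>gap_ge\<close>).

  Joining a new vertex to at most \<open>k - 1\<close> old ones keeps a graph free, because the new vertex
  can be cut off from anything that contains it. Doing this greedily attains \<open>f n\<close>. A free
  graph attaining the bound is saturated, as one more edge would violate the bound; hence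
  \<open>f n\<close> is the extremal number.

  For the structure of an extremal graph it is enough to find a vertex of degree less than \<open>k\<close>:
  deleting it leaves a free graph, and since \<open>f\<close> drops by exactly \<open>k - 1\<close>, that graph is
  again extremal and the degree was \<open>k - 1\<close>. Such a vertex is a smallest vertex set with fewer
  than \<open>k\<close> outgoing edges (\<open>extremal_low_degree_vertex\<close>). For \<open>k \<ge> 3\<close> the defect is
  strictly larger than \<open>k - 1\<close> when both sides have two or more vertices, so such a cut would
  waste edges. For \<open>k \<le> 2\<close> the defect can be exactly \<open>k - 1\<close> (split a path in the middle),
  but then a set with two or more vertices and at most one outgoing edge can be cut again into a
  smaller such set.
\<close>

definition edge_cut :: "'a graph \<Rightarrow> 'a set \<Rightarrow> 'a set set" where
  "edge_cut G A = {e \<in> edges G. e \<inter> A \<noteq> {} \<and> \<not> e \<subseteq> A}"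

definition induced :: "'a graph \<Rightarrow> 'a set \<Rightarrow> 'a graph" where
  "induced G A = Graph A {e \<in> edges G. e \<subseteq> A}"

definition contains_member :: "'a graph set \<Rightarrow> 'a graph \<Rightarrow> bool" where
  "contains_member F G \<longleftrightarrow> (\<exists>H. subgraph H G \<and> H \<in> F)"

definition max_edges :: "nat \<Rightarrow> nat \<Rightarrow> nat" where
  "max_edges k m = (\<Sum>i<m. min i (k - 1))"

section \<open>The extremal function\<close>

lemma max_edges_0 [simp]: "max_edges k 0 = 0"
  by (simp add: max_edges_def)

lemma max_edges_Suc: "max_edges k (Suc m) = max_edges k m + min m (k - 1)"
  by (simp add: max_edges_def)

lemma max_edges_small:
  assumes "m \<le> k"
  shows "max_edges k m = m choose 2"
  using assms
proof (induction m)
  case (Suc m)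
  then show ?case
    by (simp add: max_edges_Suc numeral_2_eq_2 min_def)
qed simp

lemma double_choose_two: "2 * int (m choose 2) = int m * (int m - 1)"
proof (induction m)
  case (Suc m)
  then show ?case by (simp add: numeral_2_eq_2 algebra_simps)
qed simp

lemma max_edges_large:
  assumes "k \<ge> 1" "m \<ge> k"
  shows "int (max_edges k m) = (int k - 1) * int m - int (k choose 2)"
  using assms(2)
proof (induction m rule: dec_induct)
  case base
  show ?case
    using double_choose_two[of k] by (simp add: max_edges_small algebra_simps)
next
  case (step m)
  then show ?case
    using assms(1) by (simp add: max_edges_Suc min_def of_nat_diff algebra_simps)
qed

text \<open>The edges that a split into parts of sizes \<open>a\<close> and \<open>b\<close> may have across it before the
  bound for \<open>a + b\<close> vertices is exceeded. It is an integer so that no subtraction truncates.\<close>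

definition gap :: "nat \<Rightarrow> nat \<Rightarrow> nat \<Rightarrow> int" where
  "gap k a b = int (max_edges k (a + b)) - int (max_edges k a) - int (max_edges k b)"

lemma gap_commute: "gap k a b = gap k b a"
  by (simp add: gap_def add.commute)

text \<open>The increments \<open>min m (k - 1)\<close> of \<open>max_edges k\<close> are nondecreasing in \<open>m\<close>: enlarging a part by
  one vertex adds at least as much to the whole as to the part.\<close>

lemma gap_mono_right: "b' \<le> b \<Longrightarrow> gap k a b' \<le> gap k a b"
proof (induction b rule: dec_induct)
  case (step b)
  then show ?case by (simp add: gap_def max_edges_Suc)
qed simp

lemma gap_mono:
  assumes "a' \<le> a" "b' \<le> b"
  shows "gap k a' b' \<le> gap k a b"
  using gap_mono_right[OF assms(1), of k b'] gap_mono_right[OF assms(2), of k a]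
  by (simp add: gap_commute)

text \<open>Along \<open>a + b = k + 1\<close> both parts have at most \<open>k\<close> vertices, so each term is a binomial
  coefficient up to one step and the gap is \<open>a b - 1\<close>, written here so that its excess over \<open>k - 1\<close>
  is visible.\<close>

lemma gap_at_Suc:
  assumes "a \<ge> 1" "b \<ge> 1" "a + b = Suc k"
  shows "gap k a b = int k - 1 + (int a - 1) * (int b - 1)"
proof -
  have k: "k \<ge> 1" "int k = int a + int b - 1" using assms by auto
  have "gap k a b = int (k choose 2) + (int k - 1) - int (a choose 2) - int (b choose 2)"
    using assms k(1) unfolding gap_def
    by (simp add: max_edges_small max_edges_Suc of_nat_diff)
  then have "2 * gap k a b = 2 * int (k choose 2) + 2 * (int k - 1)
      - 2 * int (a choose 2) - 2 * int (b choose 2)" by simp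
  then have "2 * gap k a b = 2 * (int k - 1 + (int a - 1) * (int b - 1))"
    unfolding double_choose_two k(2) by (simp add: algebra_simps)
  then show ?thesis by simp
qed

text \<open>By monotonicity the parts may be shrunk, keeping both nonempty, until their sizes add up to
  \<open>k + 1\<close>.\<close>

lemma gap_ge:
  assumes "a \<ge> 1" "b \<ge> 1" "a + b > k" "k \<ge> 1"
  shows "gap k a b \<ge> int k - 1"
proof -
  define a' where "a' = min a k"
  define b' where "b' = Suc k - a'"
  have *: "a' \<ge> 1" "b' \<ge> 1" "a' + b' = Suc k" "a' \<le> a" "b' \<le> b"
    using assms by (auto simp: a'_def b'_def)
  then have "int k - 1 \<le> gap k a' b'"
    using gap_at_Suc[OF *(1-3)] by simp
  also have "\<dots> \<le> gap k a b" using * by (intro gap_mono)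
  finally show ?thesis .
qed

text \<open>The same shrinking, now stopping with two vertices in each part; this needs \<open>k + 1 \<ge> 4\<close>.
  For \<open>k \<le> 2\<close> the gap is \<open>k - 1\<close> for all nonempty parts with more than \<open>k\<close> vertices in total.\<close>

lemma gap_gt:
  assumes "a \<ge> 2" "b \<ge> 2" "a + b > k" "k \<ge> 3"
  shows "gap k a b > int k - 1"
proof -
  define a' where "a' = min a (k - 1)"
  define b' where "b' = Suc k - a'"
  have *: "a' \<ge> 2" "b' \<ge> 2" "a' + b' = Suc k" "a' \<le> a" "b' \<le> b"
    using assms by (auto simp: a'_def b'_def)
  have "0 < (int a' - 1) * (int b' - 1)" using * by (intro mult_pos_pos) auto
  then have "int k - 1 < gap k a' b'"
    using gap_at_Suc[of a' b' k] * by simp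
  also have "\<dots> \<le> gap k a b" using * by (intro gap_mono)
  finally show ?thesis .
qed

section \<open>Edge cuts\<close>

lemma simple_graphD:
  assumes "simple_graph G" "e \<in> edges G"
  shows "e \<subseteq> verts G" "card e = 2"
  using assms by (auto simp: simple_graph_def all_edges_def)

lemma card_all_edges: "finite V \<Longrightarrow> card (all_edges V) = card V choose 2"
  unfolding all_edges_def by (rule n_subsets)

lemma finite_all_edges: "finite V \<Longrightarrow> finite (all_edges V)"
  by (rule finite_subset[of _ "Pow V"]) (auto simp: all_edges_def)

lemma finite_edges: "simple_graph G \<Longrightarrow> finite (edges G)"
  unfolding simple_graph_def by (meson finite_all_edges finite_subset)

lemma finite_edge_cut: "simple_graph G \<Longrightarrow> finite (edge_cut G A)"
  by (simp add: edge_cut_def finite_edges)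

lemma subgraph_refl: "simple_graph G \<Longrightarrow> subgraph G G"
  by (simp add: subgraph_def)

lemma subgraph_trans: "subgraph H G \<Longrightarrow> subgraph G K \<Longrightarrow> subgraph H K"
  by (auto simp: subgraph_def)

lemma simple_induced: "simple_graph G \<Longrightarrow> A \<subseteq> verts G \<Longrightarrow> simple_graph (induced G A)"
  by (auto simp: simple_graph_def induced_def all_edges_def intro: finite_subset)

lemma subgraph_induced: "simple_graph G \<Longrightarrow> A \<subseteq> verts G \<Longrightarrow> subgraph (induced G A) G"
  using simple_induced[of G A] by (auto simp: subgraph_def induced_def)

lemma free_subgraph:
  "\<not> contains_member F G \<Longrightarrow> subgraph H G \<Longrightarrow> \<not> contains_member F H"
  unfolding contains_member_def using subgraph_trans by blast

lemma card_2_eq_doubleton: "card e = 2 \<Longrightarrow> x \<in> e \<Longrightarrow> y \<in> e \<Longrightarrow> x \<noteq> y \<Longrightarrow> e = {x, y}"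
  by (auto simp: card_2_iff)

text \<open>If the deletion disconnects the graph, the set of vertices still reachable from a suitable vertex
  has all its outgoing edges among the deleted ones; conversely no path leaves a set whose outgoing
  edges are all deleted.\<close>

lemma connected_iff_cuts:
  assumes "simple_graph G"
  shows "connected_graph (delete_edges G D) \<longleftrightarrow>
    verts G \<noteq> {} \<and> (\<forall>A. A \<noteq> {} \<and> A \<subset> verts G \<longrightarrow> \<not> edge_cut G A \<subseteq> D)"
    (is "?conn \<longleftrightarrow> ?cuts")
proof
  let ?R = "adjacent (delete_edges G D)"
  assume conn: ?conn
  have "\<not> edge_cut G A \<subseteq> D" if A: "A \<noteq> {}" "A \<subset> verts G" for A
  proof
    assume D: "edge_cut G A \<subseteq> D"
    obtain u v where uv: "u \<in> A" "v \<in> verts G" "v \<notin> A" using A by blast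
    have "?R\<^sup>*\<^sup>* u v"
      using conn uv A by (auto simp: connected_graph_def delete_edges_def)
    then have "v \<in> A"
    proof (induction rule: rtranclp_induct)
      case (step y z)
      then have "{y, z} \<in> edges G - D" by (simp add: adjacent_def delete_edges_def)
      then have "{y, z} \<notin> edge_cut G A" "{y, z} \<in> edges G" using D by auto
      then show ?case using step.IH by (auto simp: edge_cut_def)
    qed (rule uv)
    then show False using uv by simp
  qed
  then show ?cuts using conn by (auto simp: connected_graph_def delete_edges_def)
next
  let ?R = "adjacent (delete_edges G D)"
  assume cuts: ?cuts
  have "?R\<^sup>*\<^sup>* u v" if uv: "u \<in> verts G" "v \<in> verts G" for u v
  proof (rule ccontr)
    assume nr: "\<not> ?R\<^sup>*\<^sup>* u v"
    define A where "A = {w \<in> verts G. ?R\<^sup>*\<^sup>* u w}"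
    have "A \<noteq> {}" "A \<subset> verts G" using uv nr by (auto simp: A_def)
    then obtain e where e: "e \<in> edge_cut G A" "e \<notin> D" using cuts by blast
    then have "card e = 2" "e \<subseteq> verts G"
      using simple_graphD[OF assms] by (auto simp: edge_cut_def)
    moreover obtain x y where xy: "x \<in> e" "x \<in> A" "y \<in> e" "y \<notin> A"
      using e by (auto simp: edge_cut_def)
    ultimately have "e = {x, y}" using card_2_eq_doubleton by metis
    then have "?R x y" using e by (simp add: adjacent_def delete_edges_def edge_cut_def)
    then have "y \<in> A"
      using xy \<open>e \<subseteq> verts G\<close> by (auto simp: A_def intro: rtranclp.rtrancl_into_rtrancl)
    then show False using xy by simp
  qed
  then show ?conn using cuts by (auto simp: connected_graph_def delete_edges_def)
qed

text \<open>Deletion sets enter the definition only through the cuts that they contain, so edge-connectivity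
  can be tested on cuts alone. Everything below uses this form.\<close>

lemma edge_connected_iff_cuts:
  "G \<in> edge_connected_graphs k \<longleftrightarrow> simple_graph G \<and> card (verts G) \<ge> 2 \<and>
     (\<forall>A. A \<noteq> {} \<and> A \<subset> verts G \<longrightarrow> k \<le> card (edge_cut G A))"
proof (cases "simple_graph G \<and> card (verts G) \<ge> 2")
  case True
  then have s: "simple_graph G" and ne: "verts G \<noteq> {}" by auto
  have "(\<forall>D. D \<subseteq> edges G \<and> card D < k \<longrightarrow> connected_graph (delete_edges G D))
     \<longleftrightarrow> (\<forall>A. A \<noteq> {} \<and> A \<subset> verts G \<longrightarrow> k \<le> card (edge_cut G A))"
    (is "?l \<longleftrightarrow> ?r")
  proof
    assume l: ?l
    show ?r
    proof (intro allI impI)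
      fix A assume A: "A \<noteq> {} \<and> A \<subset> verts G"
      have "edge_cut G A \<subseteq> edges G" by (auto simp: edge_cut_def)
      then show "k \<le> card (edge_cut G A)"
        using l A connected_iff_cuts[OF s, of "edge_cut G A"] by (meson not_le subset_refl)
    qed
  next
    assume r: ?r
    show ?l
    proof (intro allI impI)
      fix D assume D: "D \<subseteq> edges G \<and> card D < k"
      then have "finite D" by (auto intro: finite_subset[OF _ finite_edges[OF s]])
      have "\<not> edge_cut G A \<subseteq> D" if "A \<noteq> {}" "A \<subset> verts G" for A
      proof
        assume "edge_cut G A \<subseteq> D"
        then have "card (edge_cut G A) \<le> card D" by (rule card_mono[OF \<open>finite D\<close>])
        moreover have "k \<le> card (edge_cut G A)" using r that by blast
        ultimately show False using D by simp
      qed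
      then show "connected_graph (delete_edges G D)"
        by (simp add: connected_iff_cuts[OF s] ne)
    qed
  qed
  then show ?thesis using True by (auto simp: edge_connected_graphs_def)
qed (auto simp: edge_connected_graphs_def)

lemma free_small_cut:
  assumes "simple_graph G" "\<not> contains_member (edge_connected_graphs k) G" "card (verts G) \<ge> 2"
  obtains A where "A \<noteq> {}" "A \<subset> verts G" "card (edge_cut G A) < k"
proof -
  have "G \<notin> edge_connected_graphs k"
    using assms subgraph_refl by (auto simp: contains_member_def)
  then have "\<exists>A. A \<noteq> {} \<and> A \<subset> verts G \<and> card (edge_cut G A) < k"
    using assms(1,3) unfolding edge_connected_iff_cuts not_le[symmetric] by blast
  then show thesis using that by blast
qed

text \<open>This uses that edges are nonempty: an empty edge would lie in both induced graphs.\<close>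

lemma card_edges_split:
  assumes "simple_graph G"
  shows "card (edges G) =
    card (edges (induced G A)) + card (edges (induced G (verts G - A))) + card (edge_cut G A)"
proof -
  let ?X = "edges (induced G A)" and ?Y = "edges (induced G (verts G - A))" and ?Z = "edge_cut G A"
  have ne: "e \<noteq> {}" if "e \<in> edges G" for e
    using simple_graphD(2)[OF assms that] by auto
  have fin: "finite ?X" "finite ?Y" "finite ?Z"
    using finite_edges[OF assms] by (simp_all add: induced_def edge_cut_def)
  have "e \<in> ?X \<union> ?Y \<union> ?Z" if "e \<in> edges G" for e
    using simple_graphD(1)[OF assms that] that unfolding induced_def edge_cut_def graph.sel by blast
  then have "edges G = (?X \<union> ?Y) \<union> ?Z"
    unfolding induced_def edge_cut_def graph.sel by blast
  moreover have "card ((?X \<union> ?Y) \<union> ?Z) = card (?X \<union> ?Y) + card ?Z"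
    by (rule card_Un_disjoint) (use fin in \<open>auto simp: induced_def edge_cut_def\<close>)
  moreover have "?X \<inter> ?Y = {}"
    using ne unfolding induced_def graph.sel by blast
  then have "card (?X \<union> ?Y) = card ?X + card ?Y"
    by (intro card_Un_disjoint fin)
  ultimately show ?thesis by presburger
qed

section \<open>The upper bound\<close>

lemma card_edges_le_choose: "simple_graph G \<Longrightarrow> card (edges G) \<le> card (verts G) choose 2"
  using card_mono[OF finite_all_edges, of "verts G" "edges G"]
  by (simp add: simple_graph_def card_all_edges)

text \<open>Strong induction on the number of vertices: split along a cut with fewer than \<open>k\<close> edges, which
  the gap leaves room for.\<close>

lemma free_card_edges_le:
  assumes "k \<ge> 1" "simple_graph G" "\<not> contains_member (edge_connected_graphs k) G"
  shows "card (edges G) \<le> max_edges k (card (verts G))"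
  using assms(2,3)
proof (induction "card (verts G)" arbitrary: G rule: less_induct)
  case less
  show ?case
  proof (cases "card (verts G) \<le> k")
    case True
    then show ?thesis using card_edges_le_choose less.prems by (simp add: max_edges_small)
  next
    case False
    then have "card (verts G) \<ge> 2" using assms(1) by simp
    then obtain A where A: "A \<noteq> {}" "A \<subset> verts G" "card (edge_cut G A) < k"
      using free_small_cut less.prems by metis
    let ?B = "verts G - A"
    have fin: "finite (verts G)" using less.prems by (simp add: simple_graph_def)
    have sum: "card A + card ?B = card (verts G)"
      using A fin by (metis card_Diff_subset card_mono finite_subset le_add_diff_inverse psubset_imp_subset)
    have pos: "card A \<ge> 1" "card ?B \<ge> 1"
      using A fin by (auto simp: Suc_le_eq card_gt_0_iff finite_subset)
    have IH: "card (edges (induced G C)) \<le> max_edges k (card C)" if "C \<subset> verts G" for C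
    proof -
      have "card (verts (induced G C)) < card (verts G)"
        using psubset_card_mono[OF fin that] by (simp add: induced_def)
      moreover have "C \<subseteq> verts G" using that by simp
      ultimately show ?thesis
        using less.hyps[of "induced G C"] less.prems
          simple_induced subgraph_induced free_subgraph by (metis graph.sel(1) induced_def)
    qed
    have "?B \<subset> verts G" using A by auto
    then have "card (edges G) + 1 \<le> max_edges k (card A) + max_edges k (card ?B) + k"
      using card_edges_split[OF less.prems(1), of A] IH[OF A(2)] IH[of ?B] A(3) by linarith
    then show ?thesis
      using gap_ge[OF pos _ assms(1)] sum False by (simp add: gap_def)
  qed
qed

text \<open>Adding an edge would beat the upper bound, so it must create a \<open>k\<close>-edge-connected subgraph. This
  turns maximality among free graphs into saturation, both for the construction and for the graph
  left after deleting a vertex.\<close>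

lemma max_edges_imp_saturated:
  assumes "k \<ge> 1" "simple_graph G" "\<not> contains_member (edge_connected_graphs k) G"
    "card (edges G) = max_edges k (card (verts G))"
  shows "saturated (edge_connected_graphs k) G"
proof -
  have "contains_member (edge_connected_graphs k) (add_edge G e)"
    if "e \<in> edges (complement_graph G)" for e
  proof (rule ccontr)
    assume "\<not> ?thesis"
    moreover have e: "e \<in> all_edges (verts G)" "e \<notin> edges G"
      using that by (auto simp: complement_graph_def)
    moreover have "simple_graph (add_edge G e)"
      using assms(2) e by (auto simp: simple_graph_def add_edge_def)
    ultimately have "card (edges (add_edge G e)) \<le> max_edges k (card (verts G))"
      using free_card_edges_le[OF assms(1)] by (metis add_edge_def graph.sel(1))
    then show False
      using assms(4) e finite_edges[OF assms(2)] by (simp add: add_edge_def)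
  qed
  then show ?thesis
    using assms by (simp add: saturated_def contains_member_def)
qed

section \<open>Extremal graphs\<close>

lemma edge_cut_singleton_add_vertex:
  assumes "simple_graph H" "v \<notin> verts H" "N \<subseteq> verts H"
  shows "edge_cut (add_vertex H v N) {v} = (\<lambda>u. {v, u}) ` N"
  using assms simple_graphD(1)[OF assms(1)]
  by (auto simp: edge_cut_def add_vertex_def)

lemma inj_on_doubleton: "inj_on (\<lambda>u. {v, u}) N"
  by (auto simp: inj_on_def doubleton_eq_iff)

lemma simple_add_vertex:
  assumes "simple_graph H" "v \<notin> verts H" "N \<subseteq> verts H"
  shows "simple_graph (add_vertex H v N)"
proof -
  have "card {v, u} = 2" if "u \<in> N" for u
  proof -
    have "v \<noteq> u" using that assms by auto
    then show ?thesis by simp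
  qed
  then show ?thesis
    using assms by (auto simp: simple_graph_def add_vertex_def all_edges_def)
qed

text \<open>A \<open>k\<close>-edge-connected subgraph containing the new vertex would be disconnected by deleting the at most
  \<open>k - 1\<close> edges at it; one avoiding it would already lie in the old graph.\<close>

lemma free_add_vertex:
  assumes "simple_graph H" "\<not> contains_member (edge_connected_graphs k) H"
    "v \<notin> verts H" "N \<subseteq> verts H" "card N < k"
  shows "\<not> contains_member (edge_connected_graphs k) (add_vertex H v N)"
proof
  let ?G = "add_vertex H v N"
  assume "contains_member (edge_connected_graphs k) ?G"
  then obtain K where K: "subgraph K ?G" "K \<in> edge_connected_graphs k"
    by (auto simp: contains_member_def)
  have sK: "simple_graph K" "card (verts K) \<ge> 2"
    using K by (auto simp: edge_connected_iff_cuts)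
  show False
  proof (cases "v \<in> verts K")
    case True
    have "verts K \<noteq> {v}" using sK by auto
    then have "{v} \<subset> verts K" using True by auto
    then have "k \<le> card (edge_cut K {v})"
      using K(2) by (simp add: edge_connected_iff_cuts)
    also have "\<dots> \<le> card (edge_cut ?G {v})"
      using K(1) by (intro card_mono finite_edge_cut simple_add_vertex assms)
        (auto simp: edge_cut_def subgraph_def)
    also have "\<dots> = card N"
      by (simp add: edge_cut_singleton_add_vertex[OF assms(1,3,4)] card_image inj_on_doubleton)
    finally show False using assms(5) by simp
  next
    case False
    then have "subgraph K H"
      using K(1) simple_graphD(1)[OF sK(1)] by (auto simp: subgraph_def add_vertex_def)
    then show False using K(2) assms(2) by (auto simp: contains_member_def)
  qed
qed

lemma card_edges_add_vertex:
  assumes "simple_graph H" "v \<notin> verts H" "N \<subseteq> verts H"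
  shows "card (edges (add_vertex H v N)) = card (edges H) + card N"
proof -
  have "edges (add_vertex H v N) = edges H \<union> (\<lambda>u. {v, u}) ` N"
    by (auto simp: add_vertex_def)
  moreover have "edges H \<inter> (\<lambda>u. {v, u}) ` N = {}"
    using assms simple_graphD(1)[OF assms(1)] by auto
  moreover have "finite N" using assms by (auto simp: simple_graph_def intro: finite_subset)
  ultimately show ?thesis
    using finite_edges[OF assms(1)]
    by (simp add: card_Un_disjoint card_image inj_on_doubleton)
qed

text \<open>Join each new vertex to as many of the first \<open>k - 1\<close> vertices as exist, which realises the
  increments of \<open>max_edges k\<close> one by one.\<close>

lemma extremal_graph_exists:
  assumes "k \<ge> 1"
  shows "\<exists>G :: nat graph. simple_graph G \<and> verts G = {..<n} \<and>
    \<not> contains_member (edge_connected_graphs k) G \<and> card (edges G) = max_edges k n"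
proof (induction n)
  case 0
  have "\<not> contains_member (edge_connected_graphs k) (Graph {} {} :: nat graph)"
    by (auto simp: contains_member_def subgraph_def edge_connected_graphs_def)
  then show ?case
    by (intro exI[of _ "Graph {} {}"]) (simp add: simple_graph_def)
next
  case (Suc n)
  then obtain G :: "nat graph" where G: "simple_graph G" "verts G = {..<n}"
    "\<not> contains_member (edge_connected_graphs k) G" "card (edges G) = max_edges k n" by blast
  define N where "N = {..<min n (k - 1)}"
  have N: "n \<notin> verts G" "N \<subseteq> verts G" "card N < k"
    using G assms by (auto simp: N_def)
  show ?case
  proof (intro exI[of _ "add_vertex G n N"] conjI)
    show "simple_graph (add_vertex G n N)" by (rule simple_add_vertex[OF G(1) N(1,2)])
    show "verts (add_vertex G n N) = {..<Suc n}" by (simp add: add_vertex_def G(2) lessThan_Suc)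
    show "\<not> contains_member (edge_connected_graphs k) (add_vertex G n N)"
      by (rule free_add_vertex[OF G(1,3) N])
    show "card (edges (add_vertex G n N)) = max_edges k (Suc n)"
      using card_edges_add_vertex[OF G(1) N(1,2)] G(4) by (simp add: max_edges_Suc N_def)
  qed
qed

lemma ex_number_edge_connected:
  assumes "k \<ge> 1"
  shows "ex_number n (edge_connected_graphs k) = max_edges k n"
proof -
  let ?S = "{card (edges G) |G :: nat graph. saturated (edge_connected_graphs k) G \<and> card (verts G) = n}"
  have le: "x \<le> max_edges k n" if "x \<in> ?S" for x
    using that free_card_edges_le[OF assms]
    by (auto simp: saturated_def contains_member_def)
  moreover have "finite ?S"
    by (rule finite_subset[of _ "{..max_edges k n}"]) (use le in auto)
  moreover have "max_edges k n \<in> ?S"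
  proof -
    obtain G :: "nat graph" where G: "simple_graph G" "verts G = {..<n}"
      "\<not> contains_member (edge_connected_graphs k) G" "card (edges G) = max_edges k n"
      using extremal_graph_exists[OF assms] by blast
    then have "saturated (edge_connected_graphs k) G"
      by (intro max_edges_imp_saturated[OF assms]) simp_all
    then show ?thesis using G by force
  qed
  ultimately show ?thesis unfolding ex_number_def by (intro Max_eqI) auto
qed

section \<open>Peeling off a vertex\<close>

text \<open>The side \<open>A\<close> of a cut is itself free, so it splits into two parts joined by fewer than \<open>k\<close>
  edges. The original cut has at most one edge, and that edge meets only one of the two parts. The
  other part therefore sends edges only to its sibling, hence fewer than \<open>k\<close>.\<close>

lemma smaller_cut_of_low_connectivity:
  assumes "simple_graph G" "\<not> contains_member (edge_connected_graphs k) G" "k \<le> 2"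
    "A \<subseteq> verts G" "card A \<ge> 2" "card (edge_cut G A) < k"
  obtains A' where "A' \<noteq> {}" "A' \<subset> A" "card (edge_cut G A') < k"
proof -
  have "\<not> contains_member (edge_connected_graphs k) (induced G A)"
    by (rule free_subgraph[OF assms(2) subgraph_induced[OF assms(1,4)]])
  then obtain B where B: "B \<noteq> {}" "B \<subset> A" "card (edge_cut (induced G A) B) < k"
    using free_small_cut[OF simple_induced[OF assms(1,4)]] assms(5)
    by (metis graph.sel(1) induced_def)
  let ?C = "A - B"
  have fin: "finite (edge_cut (induced G A) B)" "finite (edge_cut G A)"
    by (rule finite_edge_cut[OF simple_induced[OF assms(1,4)]], rule finite_edge_cut[OF assms(1)])
  have "edge_cut G B \<subseteq> edge_cut (induced G A) B \<or> edge_cut G ?C \<subseteq> edge_cut (induced G A) B"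
  proof (rule ccontr)
    assume "\<not> ?thesis"
    then obtain e f where e: "e \<in> edge_cut G B" "e \<notin> edge_cut (induced G A) B"
      and f: "f \<in> edge_cut G ?C" "f \<notin> edge_cut (induced G A) B" by blast
    \<comment> \<open>Both parts would own an edge of the original cut, which has only one edge; that edge would then
      have an endpoint in each part and a third one outside \<open>A\<close>.\<close>
    have out: "e \<in> edge_cut G A" "f \<in> edge_cut G A"
      using e f B unfolding edge_cut_def induced_def graph.sel by blast+
    have "card (edge_cut G A) \<le> Suc 0" using assms(3,6) by simp
    then have "e = f" using out by (simp add: card_le_Suc0_iff_eq[OF fin(2)])
    then obtain x y where xy: "x \<in> e" "x \<in> B" "y \<in> e" "y \<in> ?C"
      using e f unfolding edge_cut_def by blast
    have "e \<in> edges G" using e(1) by (simp add: edge_cut_def)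
    then have "card e = 2" by (rule simple_graphD[OF assms(1)])
    moreover have "x \<noteq> y" using xy by blast
    ultimately have "e = {x, y}" using xy by (intro card_2_eq_doubleton)
    then have "e \<subseteq> A" using xy B by blast
    then show False using out by (simp add: edge_cut_def)
  qed
  then obtain C where C: "C = B \<or> C = ?C" "edge_cut G C \<subseteq> edge_cut (induced G A) B" by blast
  have "card (edge_cut G C) < k" using card_mono[OF fin(1) C(2)] B(3) by simp
  moreover have "C \<noteq> {}" "C \<subset> A" using B C(1) by auto
  ultimately show thesis using that by blast
qed

text \<open>A smallest nonempty proper vertex set with fewer than \<open>k\<close> outgoing edges is a singleton. If it had
  two or more vertices, so would its complement; for \<open>k \<ge> 3\<close> the strict gap contradicts the number
  of edges, and for \<open>k \<le> 2\<close> there is a smaller set of this kind.\<close>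

lemma extremal_low_degree_vertex:
  assumes "k \<ge> 1" "simple_graph G" "\<not> contains_member (edge_connected_graphs k) G"
    "card (verts G) > k" "card (edges G) = max_edges k (card (verts G))"
  obtains v where "v \<in> verts G" "card (edge_cut G {v}) < k"
proof -
  define P where "P A \<longleftrightarrow> A \<noteq> {} \<and> A \<subset> verts G \<and> card (edge_cut G A) < k" for A
  have "card (verts G) \<ge> 2" using assms(1,4) by simp
  then obtain A\<^sub>0 where "P A\<^sub>0"
    using free_small_cut[OF assms(2,3)] unfolding P_def by metis
  then obtain A where A: "P A" and least: "\<And>B. P B \<Longrightarrow> card A \<le> card B"
    using ex_has_least_nat[of P _ card] by blast
  let ?B = "verts G - A"
  have fin: "finite (verts G)" "finite A"
    using A assms(2) by (auto simp: simple_graph_def P_def intro: finite_subset)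
  have sub: "A \<subseteq> verts G" "?B \<subseteq> verts G" "A \<noteq> {}" "A \<subset> verts G" "card (edge_cut G A) < k"
    using A by (auto simp: P_def)
  have compl_cut: "edge_cut G ?B = edge_cut G A"
    using simple_graphD(1)[OF assms(2)] unfolding edge_cut_def by blast
  \<comment> \<open>The complement has the same cut, so by minimality it is at least as large as \<open>A\<close>.\<close>
  then have "P ?B" using A by (auto simp: P_def)
  then have AB: "card A \<le> card ?B" by (rule least)
  have sum: "card A + card ?B = card (verts G)"
    using fin sub by (simp add: card_Diff_subset card_mono)
  have "card A < 2"
  proof (rule ccontr)
    assume "\<not> card A < 2"
    then have two: "card A \<ge> 2" "card ?B \<ge> 2" using AB by auto
    show False
    proof (cases "k \<le> 2")
      case True
      then obtain A' where A': "A' \<noteq> {}" "A' \<subset> A" "card (edge_cut G A') < k"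
        using smaller_cut_of_low_connectivity[OF assms(2,3) True sub(1) two(1) sub(5)] by blast
      then have "P A'" using sub by (auto simp: P_def)
      then have "card A \<le> card A'" by (rule least)
      then show False using psubset_card_mono[OF fin(2) A'(2)] by simp
    next
      case False
      have bound: "card (edges (induced G C)) \<le> max_edges k (card C)" if "C \<subseteq> verts G" for C
        using free_card_edges_le[OF assms(1) simple_induced[OF assms(2) that]]
          free_subgraph[OF assms(3) subgraph_induced[OF assms(2) that]] by (simp add: induced_def)
      have "gap k (card A) (card ?B) \<le> int k - 1"
        using card_edges_split[OF assms(2), of A] bound[OF sub(1)] bound[OF sub(2)]
          sub(5) assms(5) sum by (simp add: gap_def)
      then show False using gap_gt[OF two, of k] False assms(4) sum by simp
    qed
  qed
  moreover have "card A \<noteq> 0" using fin sub by simp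
  ultimately have "card A = 1" by linarith
  then obtain v where "A = {v}" by (auto simp: card_1_singleton_iff)
  then show thesis using that sub by auto
qed

lemma add_vertex_induced:
  assumes "simple_graph G" "v \<in> verts G"
  defines "N \<equiv> {u. {v, u} \<in> edges G}"
  shows "N \<subseteq> verts G - {v}" "G = add_vertex (induced G (verts G - {v})) v N"
    "card (edge_cut G {v}) = card N"
proof -
  show N: "N \<subseteq> verts G - {v}"
    using simple_graphD[OF assms(1)] by (fastforce simp: N_def)
  have "e \<in> (\<lambda>u. {v, u}) ` N" if "e \<in> edges G" "\<not> e \<subseteq> verts G - {v}" for e
  proof -
    have "card e = 2" "v \<in> e" using that simple_graphD[OF assms(1)] by auto
    then obtain u where "e = {v, u}" by (auto simp: card_2_iff)
    then show ?thesis using that by (auto simp: N_def)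
  qed
  then have "edges (add_vertex (induced G (verts G - {v})) v N) = edges G"
    by (auto simp: add_vertex_def induced_def N_def)
  moreover have "verts (add_vertex (induced G (verts G - {v})) v N) = verts G"
    using assms(2) by (auto simp: add_vertex_def induced_def)
  ultimately show G: "G = add_vertex (induced G (verts G - {v})) v N"
    by (simp add: graph.expand)
  show "card (edge_cut G {v}) = card N"
  proof (subst G, subst edge_cut_singleton_add_vertex)
    show "simple_graph (induced G (verts G - {v}))"
      by (rule simple_induced[OF assms(1)]) simp
  qed (use N in \<open>auto simp: induced_def card_image inj_on_doubleton\<close>)
qed

text \<open>Deleting a vertex of degree less than \<open>k\<close> loses at most \<open>k - 1\<close> edges, while the bound drops by
  exactly \<open>k - 1\<close>; so the degree is \<open>k - 1\<close> and the rest meets its own bound.\<close>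

lemma extremal_is_add_vertex:
  assumes "k \<ge> 1" "simple_graph G" "\<not> contains_member (edge_connected_graphs k) G"
    "card (verts G) > k" "card (edges G) = max_edges k (card (verts G))"
  obtains H v N where "saturated (edge_connected_graphs k) H" "card (verts H) = card (verts G) - 1"
    "card (edges H) = max_edges k (card (verts G) - 1)"
    "v \<notin> verts H" "N \<subseteq> verts H" "card N = k - 1" "G = add_vertex H v N"
proof -
  obtain v where v: "v \<in> verts G" "card (edge_cut G {v}) < k"
    using extremal_low_degree_vertex[OF assms] .
  define H where "H = induced G (verts G - {v})"
  define N where "N = {u. {v, u} \<in> edges G}"
  note split = add_vertex_induced[OF assms(2) v(1), folded N_def H_def]
  have vH: "verts H = verts G - {v}" by (simp add: H_def induced_def)
  have H: "simple_graph H" "\<not> contains_member (edge_connected_graphs k) H"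
    unfolding H_def
    by (rule simple_induced[OF assms(2)], simp)
      (rule free_subgraph[OF assms(3) subgraph_induced[OF assms(2)]], simp)
  have cH: "card (verts H) = card (verts G) - 1" using v(1) by (simp add: vH)
  have N: "v \<notin> verts H" "N \<subseteq> verts H" using split(1) by (auto simp: vH)
  have edges: "card (edges G) = card (edges H) + card N"
    using card_edges_add_vertex[OF H(1) N] split(2) by simp
  have "max_edges k (card (verts G)) = max_edges k (card (verts G) - 1) + (k - 1)"
    using max_edges_Suc[of k "card (verts G) - 1"] assms(1,4) by (simp add: min_def)
  then have tight: "card N = k - 1" "card (edges H) = max_edges k (card (verts G) - 1)"
    using edges assms(5) v(2) split(3) free_card_edges_le[OF assms(1) H] cH by auto
  then have "saturated (edge_connected_graphs k) H"
    using max_edges_imp_saturated[OF assms(1) H] cH by simp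
  then show thesis using that cH tight N split(2) by blast
qed

theorem theorem3p5:
  fixes k n :: nat
  assumes "k \<ge> 1" and "n \<ge> k + 1"
  shows "int (ex_number n (edge_connected_graphs k)) = (int k - 1) * int n - int (k choose 2)
    \<and> (\<forall>G :: 'a graph.
          saturated (edge_connected_graphs k) G \<and> card (verts G) = n
          \<and> card (edges G) = ex_number n (edge_connected_graphs k)
          \<longrightarrow> (\<exists>H v N. saturated (edge_connected_graphs k) H \<and> card (verts H) = n - 1
                \<and> card (edges H) = ex_number (n - 1) (edge_connected_graphs k)
                \<and> v \<notin> verts H \<and> N \<subseteq> verts H \<and> card N = k - 1
                \<and> G = add_vertex H v N))"
proof (intro conjI allI impI)
  note ex = ex_number_edge_connected[OF assms(1)]
  show "int (ex_number n (edge_connected_graphs k)) = (int k - 1) * int n - int (k choose 2)"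
    using max_edges_large assms by (simp add: ex)
  fix G :: "'a graph"
  assume G: "saturated (edge_connected_graphs k) G \<and> card (verts G) = n
    \<and> card (edges G) = ex_number n (edge_connected_graphs k)"
  then have "simple_graph G" "\<not> contains_member (edge_connected_graphs k) G"
    "card (verts G) > k" "card (edges G) = max_edges k (card (verts G))"
    using assms by (auto simp: saturated_def contains_member_def ex)
  from extremal_is_add_vertex[OF assms(1) this] G
  show "\<exists>H v N. saturated (edge_connected_graphs k) H \<and> card (verts H) = n - 1
      \<and> card (edges H) = ex_number (n - 1) (edge_connected_graphs k)
      \<and> v \<notin> verts H \<and> N \<subseteq> verts H \<and> card N = k - 1 \<and> G = add_vertex H v N"
    by (metis ex)
qed

end
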